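(* Let $n\ge1$, let $m_1,\dots,m_n$ be positive integers and let $\alpha_i,\beta_i>0$ for $i=1,\dots,n$. In the Bayesian model described in the context, put $$\hat w_i^{\mathrm{Ba}}=\log\frac{\alpha_i+k_i}{\beta_i+m_i-k_i},\qquad \hat f^{\mathrm{Ba}}(\mathbf{x},\mathbf{k})=\operatorname{sign}\left(\sum_{i=1}^n\hat w_i^{\mathrm{Ba}}x_i\right),$$ where $\operatorname{sign}(0)$ may be assigned either value in $\{\pm1\}$. Then for every $\mathbf{x}\in\{\pm1\}^n$ and every $\mathbf{k}\in\prod_{i=1}^n\{0,1,\dots,m_i\}$, the choice $y=\hat f^{\mathrm{Ba}}(\mathbf{x},\mathbf{k})$ maximizes $\mathbb{P}(Y=y\mid\mathbf{X}=\mathbf{x},\mathbf{K}=\mathbf{k})$ over $y\in\{\pm1\}$. Consequently $\hat f^{\mathrm{Ba}}$ is Bayes-optimal: it minimizes $\mathbb{P}(\hat f(\mathbf{X},\mathbf{K})\ne Y)$ over all empirical decision rules $\hat f:(\mathbf{x},\mathbf{k})\mapsto\{\pm1\}$.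
   Context: Bayesian model: the competences $p_1,\dots,p_n$ are drawn independently with $p_i\sim\mathrm{Beta}(\alpha_i,\beta_i)$. The truth $Y\in\{\pm1\}$ is uniform and independent of $(p_1,\dots,p_n)$. Given $(p_1,\dots,p_n)$, expert $i$ is queried independently $m_i$ times, giving $k_i\sim\mathrm{Binomial}(m_i,p_i)$ correct predictions, and casts a vote $X_i\in\{\pm1\}$ on $Y$ with correctness indicator $\mathbf{1}\{X_i=Y\}\sim\mathrm{Bernoulli}(p_i)$; conditionally on $(p_1,\dots,p_n)$, all the $k_i$, all the correctness indicators and $Y$ are mutually independent. Write $\mathbf{X}=(X_1,\dots,X_n)$ and $\mathbf{K}=(k_1,\dots,k_n)$ (the committee profile). All probabilities are over $(p_1,\dots,p_n)$, $\mathbf{X}$, $Y$ and $\mathbf{K}$. *)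

theory Defs
  imports "HOL-Probability.Probability"
begin

section \<open>Conditional probability and conditional independence given a sub-sigma-algebra\<close>

definition cond_prob_given :: "'a measure \<Rightarrow> 'a measure \<Rightarrow> 'a set \<Rightarrow> 'a \<Rightarrow> real" where
  "cond_prob_given M F A = real_cond_exp M F (indicator A)"

text \<open>Conditional analogue of \<open>prob_space.indep_sets\<close>: the product formula holds almost surely
  for the conditional probabilities given \<open>F\<close>.\<close>

definition cond_indep_sets ::
    "'a measure \<Rightarrow> 'a measure \<Rightarrow> ('i \<Rightarrow> 'a set set) \<Rightarrow> 'i set \<Rightarrow> bool" where
  "cond_indep_sets M F G I \<longleftrightarrow> (\<forall>i\<in>I. G i \<subseteq> sets M) \<and>
    (\<forall>J\<subseteq>I. J \<noteq> {} \<longrightarrow> finite J \<longrightarrow> (\<forall>A\<in>Pi J G.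
       AE \<omega> in M. cond_prob_given M F (\<Inter>j\<in>J. A j) \<omega> = (\<Prod>j\<in>J. cond_prob_given M F (A j) \<omega>)))"

definition rv_events :: "'a measure \<Rightarrow> 'b measure \<Rightarrow> ('a \<Rightarrow> 'b) \<Rightarrow> 'a set set" where
  "rv_events M N Z = {Z -` A \<inter> space M | A. A \<in> sets N}"

section \<open>The Bayesian committee model\<close>

definition beta_density :: "real \<Rightarrow> real \<Rightarrow> real \<Rightarrow> real" where
  "beta_density a b x =
     (if 0 < x \<and> x < 1 then x powr (a - 1) * (1 - x) powr (b - 1) / Beta a b else 0)"

definition tuple :: "nat \<Rightarrow> (nat \<Rightarrow> 'a \<Rightarrow> 'b) \<Rightarrow> 'a \<Rightarrow> nat \<Rightarrow> 'b" where
  "tuple n Z \<omega> = (\<lambda>i\<in>{1..n}. Z i \<omega>)"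

definition sigma_of_tuple :: "'a measure \<Rightarrow> nat \<Rightarrow> (nat \<Rightarrow> 'a \<Rightarrow> real) \<Rightarrow> 'a measure" where
  "sigma_of_tuple M n p = vimage_algebra (space M) (tuple n p) (PiM {1..n} (\<lambda>_. borel))"

datatype variable = Truth | Count nat | Correct nat

text \<open>The competences \<open>p i\<close> are real-valued; the Beta distribution puts them in \<open>(0,1)\<close> almost surely,
  so the values of the binomial distribution outside \<open>[0,1]\<close> are irrelevant.\<close>

locale bayes_committee = prob_space M for M :: "'a measure" +
  fixes n :: nat
    and m :: "nat \<Rightarrow> nat"
    and \<alpha> \<beta> :: "nat \<Rightarrow> real"
    and p :: "nat \<Rightarrow> 'a \<Rightarrow> real"
    and Y :: "'a \<Rightarrow> int"
    and k :: "nat \<Rightarrow> 'a \<Rightarrow> nat"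
    and X :: "nat \<Rightarrow> 'a \<Rightarrow> int"
  assumes competence_indep: "indep_vars (\<lambda>_. borel) p {1..n}"
    and competence_beta:
      "\<And>i. i \<in> {1..n} \<Longrightarrow> distributed M lborel (p i) (\<lambda>x. ennreal (beta_density (\<alpha> i) (\<beta> i) x))"
    and truth_rv: "Y \<in> measurable M (count_space {-1, 1})"
    and truth_uniform: "distr M (count_space {-1, 1}) Y = uniform_count_measure {-1, 1}"
    and truth_indep:
      "indep_set (rv_events M (count_space {-1, 1}) Y)
         (rv_events M (PiM {1..n} (\<lambda>_. borel)) (tuple n p))"
    and count_rv: "\<And>i. i \<in> {1..n} \<Longrightarrow> k i \<in> measurable M (count_space UNIV)"
    and vote_rv: "\<And>i. i \<in> {1..n} \<Longrightarrow> X i \<in> measurable M (count_space {-1, 1})"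
    and count_binomial:
      "\<And>i j. i \<in> {1..n} \<Longrightarrow>
         AE \<omega> in M. cond_prob_given M (sigma_of_tuple M n p) {\<omega>' \<in> space M. k i \<omega>' = j} \<omega>
           = pmf (binomial_pmf (m i) (p i \<omega>)) j"
    and correct_bernoulli:
      "\<And>i c. i \<in> {1..n} \<Longrightarrow>
         AE \<omega> in M. cond_prob_given M (sigma_of_tuple M n p) {\<omega>' \<in> space M. (X i \<omega>' = Y \<omega>') = c} \<omega>
           = pmf (bernoulli_pmf (p i \<omega>)) c"
    and cond_indep:
      "cond_indep_sets M (sigma_of_tuple M n p)
         (\<lambda>v. case v of
            Truth \<Rightarrow> rv_events M (count_space {-1, 1}) Y
          | Count i \<Rightarrow> rv_events M (count_space UNIV) (k i)
          | Correct i \<Rightarrow> rv_events M (count_space UNIV) (\<lambda>\<omega>. X i \<omega> = Y \<omega>))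
         ({Truth} \<union> Count ` {1..n} \<union> Correct ` {1..n})"

section \<open>Decision rules\<close>

definition vote_profiles :: "nat \<Rightarrow> (nat \<Rightarrow> int) set" where
  "vote_profiles n = {1..n} \<rightarrow>\<^sub>E {-1, 1}"

definition committee_profiles :: "nat \<Rightarrow> (nat \<Rightarrow> nat) \<Rightarrow> (nat \<Rightarrow> nat) set" where
  "committee_profiles n m = (\<Pi>\<^sub>E i\<in>{1..n}. {0..m i})"

definition decision_rules ::
    "nat \<Rightarrow> (nat \<Rightarrow> nat) \<Rightarrow> ((nat \<Rightarrow> int) \<times> (nat \<Rightarrow> nat) \<Rightarrow> int) set" where
  "decision_rules n m = vote_profiles n \<times> committee_profiles n m \<rightarrow> {-1, 1}"

text \<open>The parameter \<open>s\<close> is the value assigned to the sign of zero.\<close>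

definition sign_with :: "int \<Rightarrow> real \<Rightarrow> int" where
  "sign_with s t = (if t > 0 then 1 else if t < 0 then -1 else s)"

definition bayes_weight :: "real \<Rightarrow> real \<Rightarrow> nat \<Rightarrow> nat \<Rightarrow> real" where
  "bayes_weight a b mi ki = ln ((a + real ki) / (b + real mi - real ki))"

definition bayes_rule ::
    "int \<Rightarrow> nat \<Rightarrow> (nat \<Rightarrow> nat) \<Rightarrow> (nat \<Rightarrow> real) \<Rightarrow> (nat \<Rightarrow> real)
      \<Rightarrow> (nat \<Rightarrow> int) \<times> (nat \<Rightarrow> nat) \<Rightarrow> int" where
  "bayes_rule s n m \<alpha> \<beta> = (\<lambda>(x, k).
     sign_with s (\<Sum>i=1..n. bayes_weight (\<alpha> i) (\<beta> i) (m i) (k i) * real_of_int (x i)))"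

end

theory Submission
  imports Defs
begin

text \<open>Conditionally on the competences, the event that the truth is \<open>y\<close> and the profiles are
  \<open>(x, \<kappa>)\<close> has probability \<open>1/2\<close> times a product of monomials in \<open>p i\<close> and \<open>1 - p i\<close>. Integrating
  against the Beta priors adds one to the first or the second Beta parameter according to whether
  \<open>x i = y\<close>, so the recursion of the Beta function makes the joint probability proportional to the
  product of the factors \<open>\<alpha> i + \<kappa> i\<close> (if \<open>x i = y\<close>) and \<open>\<beta> i + m i - \<kappa> i\<close> (otherwise).
  The quotient of the joint probabilities for \<open>y = 1\<close> and \<open>y = -1\<close> is therefore the exponential of
  the weighted vote. The success probability of any rule is the sum over all profiles of these joint
  probabilities, so a rule that maximizes each summand is optimal.\<close>

section \<open>Beta moments, conditional probabilities of independent events, signed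
  log-ratios\<close>

lemma beta_moment:
  fixes a b :: real and j l :: nat
  assumes "a > 0" "b > 0"
  shows "has_bochner_integral lborel (\<lambda>x. beta_density a b x * (x ^ j * (1 - x) ^ l))
           (Beta (a + real j) (b + real l) / Beta a b)"
proof -
  let ?f = "\<lambda>x. indicator {0<..<1} x * (x powr (a + real j - 1) * (1 - x) powr (b + real l - 1)) :: real"
  \<comment> \<open>The Euler integral over the closed unit interval; dropping the two endpoints
    matches the support of \<open>beta_density\<close>.\<close>
  have I: "((\<lambda>x. x powr (a + real j - 1) * (1 - x) powr (b + real l - 1))
      has_integral Beta (a + real j) (b + real l)) {0<..<1}"
    using has_integral_Beta_real[of "a + real j" "b + real l"] assms
    by (simp add: has_integral_Icc_iff_Ioo)
  have "has_bochner_integral lborel ?f (Beta (a + real j) (b + real l))"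
  proof (rule has_bochner_integral_nn_integral)
    show "(\<integral>\<^sup>+x. ennreal (?f x) \<partial>lborel) = ennreal (Beta (a + real j) (b + real l))"
      by (rule nn_integral_has_integral_lebesgue[OF _ I]) simp
    show "0 \<le> Beta (a + real j) (b + real l)"
      using assms by (simp add: Beta_def Gamma_real_nonneg)
  qed auto
  then have "has_bochner_integral lborel (\<lambda>x. ?f x / Beta a b)
      (Beta (a + real j) (b + real l) / Beta a b)"
    by (rule has_bochner_integral_divide_zero)
  \<comment> \<open>On the support both bases are positive, so natural powers merge with the
    \<open>powr\<close> exponents; elsewhere both sides vanish.\<close>
  moreover have "?f x / Beta a b = beta_density a b x * (x ^ j * (1 - x) ^ l)" for x
  proof (cases "0 < x \<and> x < 1")
    case True
    then have "x powr (a + real j - 1) = x powr (a - 1) * x ^ j"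
      and "(1 - x) powr (b + real l - 1) = (1 - x) powr (b - 1) * (1 - x) ^ l"
      by (simp_all add: powr_realpow[symmetric] powr_add[symmetric] algebra_simps)
    with True show ?thesis by (simp add: beta_density_def)
  qed (auto simp: beta_density_def indicator_def)
  ultimately show ?thesis by simp
qed

lemma Beta_real_pos: "a > 0 \<Longrightarrow> b > 0 \<Longrightarrow> Beta a b > (0::real)"
  by (simp add: Beta_def Gamma_real_pos)

lemma beta_density_nonneg: "a > 0 \<Longrightarrow> b > 0 \<Longrightarrow> beta_density a b x \<ge> 0"
  using Beta_real_pos[of a b] by (auto simp: beta_density_def)

text \<open>By the product formula, the constant \<open>measure M A\<close> and the indicator of
  \<open>A\<close> have the same integral over every event of \<open>F\<close>, which characterizes
  the conditional expectation.\<close>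

lemma real_cond_exp_indep_event:
  assumes "prob_space M" "subalgebra M F" "A \<in> sets M"
    and indep: "\<And>B. B \<in> sets F \<Longrightarrow> measure M (A \<inter> B) = measure M A * measure M B"
  shows "AE \<omega> in M. real_cond_exp M F (indicator A) \<omega> = measure M A"
proof -
  interpret prob_space M by fact
  interpret finite_measure_subalgebra M F by unfold_locales fact
  show ?thesis
  proof (rule real_cond_exp_charact)
    fix B assume B: "B \<in> sets F"
    then have "B \<in> sets M" using subalg by (auto simp: subalgebra_def)
    then show "(\<integral>\<omega>\<in>B. indicator A \<omega> \<partial>M) = (\<integral>\<omega>\<in>B. measure M A \<partial>M)"
      using indep[OF B] assms(3)
      by (simp add: set_lebesgue_integral_def indicator_inter_arith[symmetric] Int_commute)
  qed (use assms(3) in \<open>auto simp: emeasure_eq_measure\<close>)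
qed

text \<open>Factor by factor: switching \<open>x i\<close> between the two signs exchanges
  \<open>A i\<close> and \<open>B i\<close>, which costs the ratio \<open>A i / B i\<close> or its
  inverse. Applied to the two truth values, it turns a likelihood ratio into a weighted
  vote.\<close>

lemma prod_eq_exp_sum_signed_ln:
  assumes "finite I" "\<And>i. i \<in> I \<Longrightarrow> A i > 0" "\<And>i. i \<in> I \<Longrightarrow> B i > 0"
    and "\<And>i. i \<in> I \<Longrightarrow> x i \<in> {-1, 1::int}"
  shows "(\<Prod>i\<in>I. if x i = 1 then A i else B i) =
    exp (\<Sum>i\<in>I. ln (A i / B i) * real_of_int (x i)) * (\<Prod>i\<in>I. if x i = - 1 then A i else (B i::real))"
proof -
  have "(if x i = 1 then A i else B i) =
      exp (ln (A i / B i) * real_of_int (x i)) * (if x i = - 1 then A i else B i)" if "i \<in> I" for i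
    using assms(2-4)[OF that] by (auto simp: exp_minus)
  then show ?thesis
    by (simp add: exp_sum[OF assms(1)] prod.distrib[symmetric])
qed

section \<open>Competences, the sigma-algebra they generate, and the marginal laws\<close>

context bayes_committee
begin

lemma competence_rv: "i \<in> {1..n} \<Longrightarrow> p i \<in> borel_measurable M"
  using competence_indep by (auto simp: indep_vars_def)

text \<open>The Beta density vanishes outside the open unit interval. This makes the usual formulas
  for \<open>binomial_pmf\<close> and \<open>bernoulli_pmf\<close> available at
  \<open>p i \<omega>\<close>.\<close>

lemma competence_unit_interval:
  assumes "i \<in> {1..n}"
  shows "AE \<omega> in M. 0 < p i \<omega> \<and> p i \<omega> < 1"
proof -
  let ?f = "\<lambda>x. ennreal (beta_density (\<alpha> i) (\<beta> i) x)"
  have D: "distributed M lborel (p i) ?f"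
    using competence_beta[OF assms] .
  have "AE x in density lborel ?f. 0 < x \<and> x < 1"
    using distributed_borel_measurable[OF D]
    by (subst AE_density) (auto simp: beta_density_def)
  then have "AE x in distr M lborel (p i). 0 < x \<and> x < 1"
    unfolding distributed_distr_eq_density[OF D] .
  then show ?thesis
    by (rule AE_distrD[rotated]) (use competence_rv[OF assms] in simp)
qed

lemma competence_moment:
  assumes i: "i \<in> {1..n}" and pos: "\<alpha> i > 0" "\<beta> i > 0"
  shows "has_bochner_integral M (\<lambda>\<omega>. p i \<omega> ^ j * (1 - p i \<omega>) ^ l)
           (Beta (\<alpha> i + real j) (\<beta> i + real l) / Beta (\<alpha> i) (\<beta> i))"
  using beta_moment[OF pos, of j l] beta_density_nonneg[OF pos]
    distributed_integral[OF competence_beta[OF i], of "\<lambda>x. x ^ j * (1 - x) ^ l"]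
    distributed_integrable[OF competence_beta[OF i], of "\<lambda>x. x ^ j * (1 - x) ^ l"]
  by (simp add: has_bochner_integral_iff)

lemma tuple_rv: "tuple n p \<in> M \<rightarrow>\<^sub>M PiM {1..n} (\<lambda>_. borel)"
  unfolding tuple_def using competence_rv by (intro measurable_restrict) auto

text \<open>Identifies the conditioning sigma-algebra with the event family in
  \<open>truth_indep\<close>, so that independence of truth and competences can be used
  conditionally.\<close>

lemma sets_sigma_of_tuple:
  "sets (sigma_of_tuple M n p) = rv_events M (PiM {1..n} (\<lambda>_. borel)) (tuple n p)"
  unfolding sigma_of_tuple_def rv_events_def
  by (subst sets_vimage_algebra2) (use measurable_space[OF tuple_rv] in auto)

lemma subalgebra_sigma_of_tuple: "subalgebra M (sigma_of_tuple M n p)"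
  unfolding subalgebra_def sets_sigma_of_tuple
  using measurable_sets[OF tuple_rv] by (auto simp: sigma_of_tuple_def rv_events_def)

lemma rv_event_eq: "c \<in> space N \<Longrightarrow> {c} \<in> sets N \<Longrightarrow> {\<omega> \<in> space M. Z \<omega> = c} \<in> rv_events M N Z"
  unfolding rv_events_def by (rule CollectI, rule exI[of _ "{c}"]) auto

lemma truth_values: "\<omega> \<in> space M \<Longrightarrow> Y \<omega> \<in> {-1, 1}"
  using measurable_space[OF truth_rv] by simp

lemma vote_values: "i \<in> {1..n} \<Longrightarrow> \<omega> \<in> space M \<Longrightarrow> X i \<omega> \<in> {-1, 1}"
  using measurable_space[OF vote_rv] by simp

lemma truth_prob:
  assumes "y \<in> {-1, 1}"
  shows "prob {\<omega> \<in> space M. Y \<omega> = y} = 1 / 2"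
proof -
  have "{\<omega> \<in> space M. Y \<omega> = y} = Y -` {y} \<inter> space M" by auto
  then have "prob {\<omega> \<in> space M. Y \<omega> = y} = measure (distr M (count_space {-1, 1}) Y) {y}"
    using assms by (subst measure_distr[OF truth_rv]) auto
  also have "\<dots> = 1 / 2"
    unfolding truth_uniform using assms by (subst measure_uniform_count_measure) auto
  finally show ?thesis .
qed

text \<open>The truth is independent of the competences, so conditioning on them leaves its uniform
  law unchanged.\<close>

lemma cond_prob_truth:
  assumes y: "y \<in> {-1, 1}"
  shows "AE \<omega> in M. cond_prob_given M (sigma_of_tuple M n p) {\<omega> \<in> space M. Y \<omega> = y} \<omega> = 1 / 2"
proof -
  have ev: "{\<omega> \<in> space M. Y \<omega> = y} \<in> rv_events M (count_space {-1, 1}) Y"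
    using y by (intro rv_event_eq) auto
  show ?thesis
    unfolding cond_prob_given_def truth_prob[OF y, symmetric]
  proof (rule real_cond_exp_indep_event[OF prob_space_axioms subalgebra_sigma_of_tuple])
    show "{\<omega> \<in> space M. Y \<omega> = y} \<in> events"
      using indep_setD_ev1[OF truth_indep] ev by blast
  qed (rule indep_setD[OF truth_indep ev], simp add: sets_sigma_of_tuple)
qed

text \<open>A value above \<open>m i\<close> has conditional probability zero under the binomial
  law, hence probability zero; there are only countably many such values.\<close>

lemma count_le:
  assumes i: "i \<in> {1..n}"
  shows "AE \<omega> in M. k i \<omega> \<le> m i"
proof -
  interpret S: finite_measure_subalgebra M "sigma_of_tuple M n p"
    by unfold_locales (rule subalgebra_sigma_of_tuple)
  have "AE \<omega> in M. k i \<omega> \<noteq> j" if j: "j > m i" for j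
  proof -
    let ?A = "{\<omega> \<in> space M. k i \<omega> = j}"
    have [measurable]: "k i \<in> M \<rightarrow>\<^sub>M count_space UNIV" using count_rv[OF i] .
    have A: "?A \<in> events" by measurable
    have "prob ?A = (\<integral>\<omega>. real_cond_exp M (sigma_of_tuple M n p) (indicator ?A) \<omega> \<partial>M)"
      using A by (subst S.real_cond_exp_int) (auto simp: emeasure_eq_measure)
    also have "\<dots> = (\<integral>\<omega>. 0 \<partial>M)"
    proof (intro integral_cong_AE)
      show "AE \<omega> in M. real_cond_exp M (sigma_of_tuple M n p) (indicator ?A) \<omega> = 0"
        using count_binomial[OF i, of j] competence_unit_interval[OF i]
        unfolding cond_prob_given_def by eventually_elim (use j in simp)
    qed auto
    finally show ?thesis
      using A by (subst AE_iff_measurable[OF A]) (auto simp: emeasure_eq_measure)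
  qed
  then have "AE \<omega> in M. \<forall>j. j > m i \<longrightarrow> k i \<omega> \<noteq> j"
    by (subst AE_all_countable) auto
  then show ?thesis by eventually_elim (use not_le in blast)
qed

section \<open>Conditional probability of a full profile given the competences\<close>

text \<open>Once the truth is fixed, a vote in {-1, 1} is determined by its correctness. Votes can
  thus be replaced by correctness indicators, the variables to which \<open>cond_indep\<close>
  refers.\<close>

lemma profile_event_eq:
  assumes "x \<in> vote_profiles n" "y \<in> {-1, 1}"
    "\<kappa> \<in> committee_profiles n m" "\<omega> \<in> space M" "Y \<omega> = y"
  shows "tuple n X \<omega> = x \<and> tuple n k \<omega> = \<kappa> \<longleftrightarrow>
    (\<forall>i\<in>{1..n}. (X i \<omega> = Y \<omega>) = (x i = y)) \<and> (\<forall>i\<in>{1..n}. k i \<omega> = \<kappa> i)"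
proof -
  have "tuple n k \<omega> = \<kappa> \<longleftrightarrow> (\<forall>i\<in>{1..n}. k i \<omega> = \<kappa> i)"
    using assms(3) unfolding tuple_def committee_profiles_def
    by (auto simp: fun_eq_iff PiE_def extensional_def restrict_def)
  moreover have "tuple n X \<omega> = x \<longleftrightarrow> (\<forall>i\<in>{1..n}. X i \<omega> = x i)"
    using assms(1) unfolding tuple_def vote_profiles_def
    by (auto simp: fun_eq_iff PiE_def extensional_def restrict_def)
  moreover have "X i \<omega> = x i \<longleftrightarrow> (X i \<omega> = Y \<omega>) = (x i = y)" if "i \<in> {1..n}" for i
  proof -
    have "x i \<in> {-1, 1}" using assms(1) that by (auto simp: vote_profiles_def)
    with vote_values[OF that assms(4)] assms(2,5) show ?thesis by auto
  qed
  ultimately show ?thesis by auto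
qed

text \<open>Conditional independence splits the event into the truth, the counts and the correctness
  indicators. The \<open>of_bool\<close> terms in the exponents are the one extra factor that each
  vote contributes to the binomial monomial.\<close>

lemma cond_prob_joint:
  assumes x: "x \<in> vote_profiles n" and y: "y \<in> {-1, 1}" and \<kappa>: "\<kappa> \<in> committee_profiles n m"
  shows "AE \<omega> in M. cond_prob_given M (sigma_of_tuple M n p)
      {\<omega> \<in> space M. Y \<omega> = y \<and> tuple n X \<omega> = x \<and> tuple n k \<omega> = \<kappa>} \<omega> =
    1 / 2 * (\<Prod>i=1..n. real (m i choose \<kappa> i) *
      (p i \<omega> ^ (\<kappa> i + of_bool (x i = y)) * (1 - p i \<omega>) ^ (m i - \<kappa> i + of_bool (x i \<noteq> y))))"
proof -
  \<comment> \<open>\<open>A\<close> picks one event for each variable; \<open>J\<close> is the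
    whole index set of \<open>cond_indep\<close>.\<close>
  define A where "A = (\<lambda>v. case v of Truth \<Rightarrow> {\<omega> \<in> space M. Y \<omega> = y}
      | Count i \<Rightarrow> {\<omega> \<in> space M. k i \<omega> = \<kappa> i}
      | Correct i \<Rightarrow> {\<omega> \<in> space M. (X i \<omega> = Y \<omega>) = (x i = y)})"
  define J where "J = {Truth} \<union> Count ` {1..n} \<union> Correct ` {1..n}"
  define CP where "CP = cond_prob_given M (sigma_of_tuple M n p)"
  \<comment> \<open>The product over all variables is regrouped by expert, using that the
    constructors are injective with disjoint images.\<close>
  have split: "prod g J = g Truth * (\<Prod>i=1..n. g (Count i) * g (Correct i))" for g :: "variable \<Rightarrow> real"
  proof -
    have "prod g J = g Truth * prod g (Count ` {1..n} \<union> Correct ` {1..n})"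
      unfolding J_def by (subst Un_assoc, subst prod.union_disjoint) auto
    also have "prod g (Count ` {1..n} \<union> Correct ` {1..n}) =
        prod g (Count ` {1..n}) * prod g (Correct ` {1..n})"
      by (subst prod.union_disjoint) auto
    also have "\<dots> = (\<Prod>i=1..n. g (Count i) * g (Correct i))"
      by (simp add: prod.reindex inj_on_def prod.distrib)
    finally show ?thesis .
  qed
  have eq: "(\<Inter>j\<in>J. A j) = {\<omega> \<in> space M. Y \<omega> = y \<and> tuple n X \<omega> = x \<and> tuple n k \<omega> = \<kappa>}"
  proof (rule set_eqI)
    fix \<omega>
    have "\<omega> \<in> (\<Inter>j\<in>J. A j) \<longleftrightarrow> \<omega> \<in> space M \<and> Y \<omega> = y \<and>
        (\<forall>i\<in>{1..n}. (X i \<omega> = Y \<omega>) = (x i = y)) \<and> (\<forall>i\<in>{1..n}. k i \<omega> = \<kappa> i)"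
      unfolding J_def A_def by (simp add: ball_Un) blast
    then show "\<omega> \<in> (\<Inter>j\<in>J. A j) \<longleftrightarrow>
        \<omega> \<in> {\<omega> \<in> space M. Y \<omega> = y \<and> tuple n X \<omega> = x \<and> tuple n k \<omega> = \<kappa>}"
      using profile_event_eq[OF x y \<kappa>, of \<omega>] by blast
  qed
  have "A \<in> Pi J (\<lambda>v. case v of
            Truth \<Rightarrow> rv_events M (count_space {-1, 1}) Y
          | Count i \<Rightarrow> rv_events M (count_space UNIV) (k i)
          | Correct i \<Rightarrow> rv_events M (count_space UNIV) (\<lambda>\<omega>. X i \<omega> = Y \<omega>))"
    using y unfolding J_def A_def by (auto intro!: rv_event_eq)
  then have "AE \<omega> in M. CP (\<Inter>j\<in>J. A j) \<omega> = (\<Prod>j\<in>J. CP (A j) \<omega>)"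
    using cond_indep unfolding cond_indep_sets_def CP_def J_def by blast
  moreover have "AE \<omega> in M. \<forall>i\<in>{1..n}. CP (A (Count i)) \<omega> * CP (A (Correct i)) \<omega> =
      real (m i choose \<kappa> i) *
      (p i \<omega> ^ (\<kappa> i + of_bool (x i = y)) * (1 - p i \<omega>) ^ (m i - \<kappa> i + of_bool (x i \<noteq> y)))"
  proof (intro AE_finite_allI)
    fix i assume i: "i \<in> {1..n}"
    show "AE \<omega> in M. CP (A (Count i)) \<omega> * CP (A (Correct i)) \<omega> =
      real (m i choose \<kappa> i) *
      (p i \<omega> ^ (\<kappa> i + of_bool (x i = y)) * (1 - p i \<omega>) ^ (m i - \<kappa> i + of_bool (x i \<noteq> y)))"
      using count_binomial[OF i, of "\<kappa> i"] correct_bernoulli[OF i, of "x i = y"]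
        competence_unit_interval[OF i]
    proof eventually_elim
      case (elim \<omega>)
      then show ?case
        by (cases "x i = y") (simp_all add: CP_def A_def)
    qed
  qed simp
  moreover have "AE \<omega> in M. CP (A Truth) \<omega> = 1 / 2"
    using cond_prob_truth[OF y] by (simp add: CP_def A_def)
  ultimately show ?thesis
    unfolding CP_def[symmetric]
  proof eventually_elim
    case (elim \<omega>)
    then show ?case by (simp add: split eq)
  qed
qed

section \<open>Measurability of profile events\<close>

text \<open>Here \<open>y\<close> is arbitrary, so its singleton is cut down to {-1, 1} before the
  preimage is taken. Arbitrary values occur later because \<open>error_prob\<close> treats
  unrestricted rules.\<close>

lemma truth_event: "{\<omega> \<in> space M. Y \<omega> = y} \<in> events"
proof -
  have "{\<omega> \<in> space M. Y \<omega> = y} = Y -` ({y} \<inter> {-1, 1}) \<inter> space M"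
    using truth_values by blast
  also have "\<dots> \<in> events" by (rule measurable_sets[OF truth_rv]) auto
  finally show ?thesis .
qed

lemma tuple_vote_event: "{\<omega> \<in> space M. tuple n X \<omega> = x} \<in> events"
proof -
  have *: "{\<omega> \<in> space M. X i \<omega> = x i} \<in> events" if "i \<in> {1..n}" for i
  proof -
    have "{\<omega> \<in> space M. X i \<omega> = x i} = X i -` ({x i} \<inter> {-1, 1}) \<inter> space M"
      using vote_values[OF that] by blast
    also have "\<dots> \<in> events" by (rule measurable_sets[OF vote_rv[OF that]]) auto
    finally show ?thesis .
  qed
  \<comment> \<open>A \<open>tuple\<close> is \<open>undefined\<close> outside {1..n}, so equality
    also forces \<open>x\<close> to be extensional, a condition that is constant in
    \<omega>.\<close>
  have "tuple n X \<omega> = x \<longleftrightarrow> x \<in> extensional {1..n} \<and> (\<forall>i\<in>{1..n}. X i \<omega> = x i)" for \<omega>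
    unfolding tuple_def by (auto simp: fun_eq_iff extensional_def restrict_def)
  moreover have "{\<omega> \<in> space M. x \<in> extensional {1..n} \<and> (\<forall>i\<in>{1..n}. X i \<omega> = x i)} \<in> events"
    using * by (intro sets.sets_Collect_conj sets.sets_Collect_finite_All) auto
  ultimately show ?thesis by simp
qed

lemma tuple_count_event: "{\<omega> \<in> space M. tuple n k \<omega> = \<kappa>} \<in> events"
proof -
  have *: "{\<omega> \<in> space M. k i \<omega> = \<kappa> i} \<in> events" if "i \<in> {1..n}" for i
    using measurable_sets[OF count_rv[OF that], of "{\<kappa> i}"]
    by (simp add: vimage_def Int_def conj_commute)
  have "tuple n k \<omega> = \<kappa> \<longleftrightarrow> \<kappa> \<in> extensional {1..n} \<and> (\<forall>i\<in>{1..n}. k i \<omega> = \<kappa> i)" for \<omega>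
    unfolding tuple_def by (auto simp: fun_eq_iff extensional_def restrict_def)
  moreover have "{\<omega> \<in> space M. \<kappa> \<in> extensional {1..n} \<and> (\<forall>i\<in>{1..n}. k i \<omega> = \<kappa> i)} \<in> events"
    using * by (intro sets.sets_Collect_conj sets.sets_Collect_finite_All) auto
  ultimately show ?thesis by simp
qed

lemma joint_event:
  "{\<omega> \<in> space M. Y \<omega> = y \<and> tuple n X \<omega> = x \<and> tuple n k \<omega> = \<kappa>} \<in> events"
  using truth_event tuple_vote_event tuple_count_event
  by (intro sets.sets_Collect_conj)

section \<open>The joint law in closed form\<close>

text \<open>Integrating \<open>cond_prob_joint\<close> and using independence of the competences
  gives a product of Beta moments. The closed form is arranged so that the first product is free of
  \<open>x\<close> and \<open>y\<close>; the comparison of the truth values rests on the second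
  alone.\<close>

lemma joint_prob:
  assumes x: "x \<in> vote_profiles n" and y: "y \<in> {-1, 1}" and \<kappa>: "\<kappa> \<in> committee_profiles n m"
    and pos: "\<forall>i\<in>{1..n}. \<alpha> i > 0 \<and> \<beta> i > 0"
  shows "\<P>(\<omega> in M. Y \<omega> = y \<and> tuple n X \<omega> = x \<and> tuple n k \<omega> = \<kappa>) =
    1 / 2 * (\<Prod>i=1..n. real (m i choose \<kappa> i) * Beta (\<alpha> i + real (\<kappa> i)) (\<beta> i + real (m i - \<kappa> i))
        / (Beta (\<alpha> i) (\<beta> i) * (\<alpha> i + \<beta> i + real (m i)))) *
      (\<Prod>i=1..n. if x i = y then \<alpha> i + real (\<kappa> i) else \<beta> i + real (m i) - real (\<kappa> i))"
proof -
  interpret S: finite_measure_subalgebra M "sigma_of_tuple M n p"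
    by unfold_locales (rule subalgebra_sigma_of_tuple)
  let ?E = "{\<omega> \<in> space M. Y \<omega> = y \<and> tuple n X \<omega> = x \<and> tuple n k \<omega> = \<kappa>}"
  let ?h = "\<lambda>i t. real (m i choose \<kappa> i) *
      (t ^ (\<kappa> i + of_bool (x i = y)) * (1 - t) ^ (m i - \<kappa> i + of_bool (x i \<noteq> y)))"
  have h: "has_bochner_integral M (\<lambda>\<omega>. ?h i (p i \<omega>)) (real (m i choose \<kappa> i) *
      (Beta (\<alpha> i + real (\<kappa> i + of_bool (x i = y))) (\<beta> i + real (m i - \<kappa> i + of_bool (x i \<noteq> y)))
        / Beta (\<alpha> i) (\<beta> i)))" if "i \<in> {1..n}" for i
    by (intro has_bochner_integral_mult_right competence_moment that) (use pos that in auto)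
  have meas: "(\<lambda>\<omega>. 1 / 2 * (\<Prod>i=1..n. ?h i (p i \<omega>))) \<in> borel_measurable M"
    by (intro borel_measurable_times borel_measurable_prod borel_measurable_const
        borel_measurable_power borel_measurable_diff competence_rv)
  have "prob ?E = (\<integral>\<omega>. real_cond_exp M (sigma_of_tuple M n p) (indicator ?E) \<omega> \<partial>M)"
    using joint_event by (subst S.real_cond_exp_int) (auto simp: emeasure_eq_measure)
  also have "\<dots> = (\<integral>\<omega>. 1 / 2 * (\<Prod>i=1..n. ?h i (p i \<omega>)) \<partial>M)"
    using cond_prob_joint[OF x y \<kappa>] meas unfolding cond_prob_given_def
    by (intro integral_cong_AE) auto
  also have "\<dots> = 1 / 2 * (\<Prod>i=1..n. \<integral>\<omega>. ?h i (p i \<omega>) \<partial>M)"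
  proof -
    have "indep_vars (\<lambda>_. borel) (\<lambda>i \<omega>. ?h i (p i \<omega>)) {1..n}"
      by (rule indep_vars_compose2[OF competence_indep]) measurable
    then have "(\<integral>\<omega>. (\<Prod>i=1..n. ?h i (p i \<omega>)) \<partial>M) = (\<Prod>i=1..n. \<integral>\<omega>. ?h i (p i \<omega>) \<partial>M)"
      by (rule indep_vars_lebesgue_integral[OF finite_atLeastAtMost])
        (rule integrable.intros[OF h])
    then show ?thesis by simp
  qed
  also have "\<dots> = 1 / 2 * (\<Prod>i=1..n. (real (m i choose \<kappa> i) *
        Beta (\<alpha> i + real (\<kappa> i)) (\<beta> i + real (m i - \<kappa> i))
        / (Beta (\<alpha> i) (\<beta> i) * (\<alpha> i + \<beta> i + real (m i)))) *
      (if x i = y then \<alpha> i + real (\<kappa> i) else \<beta> i + real (m i) - real (\<kappa> i)))"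
  proof (intro arg_cong2[of _ _ _ _ "(*)"] prod.cong refl)
    fix i assume i: "i \<in> {1..n}"
    \<comment> \<open>The Beta parameters of the posterior after seeing the count. The natural
      subtraction in \<open>b\<close> is exact because \<open>\<kappa> i \<le> m i\<close>.\<close>
    define a b where "a = \<alpha> i + real (\<kappa> i)" and "b = \<beta> i + real (m i - \<kappa> i)"
    have le: "\<kappa> i \<le> m i" using \<kappa> i by (auto simp: committee_profiles_def PiE_def Pi_def)
    have ab: "a > 0" "b > 0" using bspec[OF pos i] by (simp_all add: a_def b_def)
    have s: "a + b = \<alpha> i + \<beta> i + real (m i)" "b = \<beta> i + real (m i) - real (\<kappa> i)"
      using le by (simp_all add: a_def b_def)
    \<comment> \<open>The vote raises one parameter by one. Both recursions share the denominator
      \<open>a + b\<close>, so correctness matters only through the factor \<open>a\<close> or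
      \<open>b\<close>.\<close>
    have l: "Beta (a + 1) b = a * Beta a b / (a + b)"
      using Beta_plus1_left[of a b] ab by (simp add: field_simps nonpos_Ints_def)
    have r: "Beta a (b + 1) = b * Beta a b / (a + b)"
      using Beta_plus1_right[of b a] ab by (simp add: field_simps nonpos_Ints_def)
    have "(\<integral>\<omega>. ?h i (p i \<omega>) \<partial>M) = real (m i choose \<kappa> i) *
      (Beta (a + of_bool (x i = y)) (b + of_bool (x i \<noteq> y)) / Beta (\<alpha> i) (\<beta> i))"
      using has_bochner_integral_integral_eq[OF h[OF i]] by (simp add: a_def b_def add.assoc)
    also have "\<dots> = (real (m i choose \<kappa> i) * Beta a b / (Beta (\<alpha> i) (\<beta> i) * (a + b))) *
      (if x i = y then a else b)"
      by (cases "x i = y") (simp_all add: l r mult_ac)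
    finally show "(\<integral>\<omega>. ?h i (p i \<omega>) \<partial>M) = (real (m i choose \<kappa> i) *
        Beta (\<alpha> i + real (\<kappa> i)) (\<beta> i + real (m i - \<kappa> i))
        / (Beta (\<alpha> i) (\<beta> i) * (\<alpha> i + \<beta> i + real (m i)))) *
      (if x i = y then \<alpha> i + real (\<kappa> i) else \<beta> i + real (m i) - real (\<kappa> i))"
      unfolding s[symmetric] a_def[symmetric] b_def[symmetric] .
  qed
  also have "\<dots> = 1 / 2 * (\<Prod>i=1..n. real (m i choose \<kappa> i) * Beta (\<alpha> i + real (\<kappa> i)) (\<beta> i + real (m i - \<kappa> i))
        / (Beta (\<alpha> i) (\<beta> i) * (\<alpha> i + \<beta> i + real (m i)))) *
      (\<Prod>i=1..n. if x i = y then \<alpha> i + real (\<kappa> i) else \<beta> i + real (m i) - real (\<kappa> i))"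
    by (simp only: prod.distrib mult.assoc)
  finally show ?thesis .
qed

text \<open>All factors of the closed form are positive. Hence conditioning on a profile never
  divides by zero.\<close>

lemma joint_prob_pos:
  assumes "x \<in> vote_profiles n" "y \<in> {-1, 1}" "\<kappa> \<in> committee_profiles n m"
    and pos: "\<forall>i\<in>{1..n}. \<alpha> i > 0 \<and> \<beta> i > 0"
  shows "\<P>(\<omega> in M. Y \<omega> = y \<and> tuple n X \<omega> = x \<and> tuple n k \<omega> = \<kappa>) > 0"
proof -
  have le: "\<kappa> i \<le> m i" if "i \<in> {1..n}" for i
    using assms(3) that by (auto simp: committee_profiles_def PiE_def Pi_def)
  show ?thesis
    unfolding joint_prob[OF assms]
  proof (intro mult_pos_pos prod_pos)
    fix i assume i: "i \<in> {1..n}"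
    have b: "real (\<kappa> i) \<le> real (m i)" using le[OF i] by simp
    show "0 < real (m i choose \<kappa> i) * Beta (\<alpha> i + real (\<kappa> i)) (\<beta> i + real (m i - \<kappa> i))
        / (Beta (\<alpha> i) (\<beta> i) * (\<alpha> i + \<beta> i + real (m i)))"
      using bspec[OF pos i] le[OF i]
      by (intro divide_pos_pos mult_pos_pos Beta_real_pos) (auto simp: add_pos_nonneg)
    show "0 < (if x i = y then \<alpha> i + real (\<kappa> i) else \<beta> i + real (m i) - real (\<kappa> i))"
      using bspec[OF pos i] b by auto
  qed auto
qed

section \<open>The weighted vote as a comparison of joint probabilities\<close>

text \<open>The joint probabilities for the two truth values have ratio \<open>exp t\<close>, where
  \<open>t\<close> is the weighted vote, so the sign of \<open>t\<close> selects the larger. At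
  \<open>t = 0\<close> they coincide and either value of \<open>s\<close> is maximal.\<close>

lemma bayes_rule_joint_maximal:
  assumes x: "x \<in> vote_profiles n" and y: "y \<in> {-1, 1}" and \<kappa>: "\<kappa> \<in> committee_profiles n m"
    and s: "s \<in> {-1, 1}"
    and pos: "\<forall>i\<in>{1..n}. \<alpha> i > 0 \<and> \<beta> i > 0"
  shows "\<P>(\<omega> in M. Y \<omega> = y \<and> tuple n X \<omega> = x \<and> tuple n k \<omega> = \<kappa>)
    \<le> \<P>(\<omega> in M. Y \<omega> = bayes_rule s n m \<alpha> \<beta> (x, \<kappa>) \<and> tuple n X \<omega> = x \<and> tuple n k \<omega> = \<kappa>)"
proof -
  define P where "P = (\<lambda>y. \<P>(\<omega> in M. Y \<omega> = y \<and> tuple n X \<omega> = x \<and> tuple n k \<omega> = \<kappa>))"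
  define t where "t = (\<Sum>i=1..n. bayes_weight (\<alpha> i) (\<beta> i) (m i) (\<kappa> i) * real_of_int (x i))"
  have A: "\<alpha> i + real (\<kappa> i) > 0" and B: "\<beta> i + real (m i) - real (\<kappa> i) > 0"
    if i: "i \<in> {1..n}" for i
  proof -
    have "\<kappa> i \<le> m i" using \<kappa> i by (auto simp: committee_profiles_def PiE_def Pi_def)
    then have "real (\<kappa> i) \<le> real (m i)" by simp
    then show "\<alpha> i + real (\<kappa> i) > 0" "\<beta> i + real (m i) - real (\<kappa> i) > 0"
      using bspec[OF pos i] by auto
  qed
  have "(\<Prod>i=1..n. if x i = 1 then \<alpha> i + real (\<kappa> i) else \<beta> i + real (m i) - real (\<kappa> i)) =
      exp t * (\<Prod>i=1..n. if x i = - 1 then \<alpha> i + real (\<kappa> i) else \<beta> i + real (m i) - real (\<kappa> i))"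
    unfolding t_def bayes_weight_def
    by (rule prod_eq_exp_sum_signed_ln) (use A B x in \<open>auto simp: vote_profiles_def\<close>)
  \<comment> \<open>The first product of the closed form is the same for both truth values, so the
    identity for the second products carries over.\<close>
  with joint_prob[OF x _ \<kappa> pos, of 1] joint_prob[OF x _ \<kappa> pos, of "-1"]
  have ratio: "P 1 = exp t * P (-1)"
    by (simp only: P_def) (simp only: insert_iff mult_ac simp_thms)
  have pos': "P (-1) > 0"
    unfolding P_def using joint_prob_pos[OF x _ \<kappa> pos, of "-1"] by simp
  have "P y \<le> P (sign_with s t)"
    using y s ratio pos' by (auto simp: sign_with_def mult_le_cancel_right1 mult_le_cancel_right2)
  then show ?thesis by (simp add: P_def t_def bayes_rule_def)
qed

lemma bayes_rule_decision: "s \<in> {-1, 1} \<Longrightarrow> bayes_rule s n m \<alpha> \<beta> \<in> decision_rules n m"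
proof -
  assume "s \<in> {-1, 1}"
  then have "sign_with s t \<in> {-1, 1}" for t by (auto simp: sign_with_def)
  then show ?thesis by (auto simp: decision_rules_def bayes_rule_def)
qed

section \<open>Error probability of a decision rule\<close>

lemma finite_profiles: "finite (vote_profiles n \<times> committee_profiles n m)"
  unfolding vote_profiles_def committee_profiles_def
  by (intro finite_cartesian_product finite_PiE) auto

text \<open>Votes lie in their range everywhere, counts only almost surely. A decision rule is
  constrained only on these profiles, so the remaining outcomes must be negligible.\<close>

lemma profiles_AE:
  "AE \<omega> in M. (tuple n X \<omega>, tuple n k \<omega>) \<in> vote_profiles n \<times> committee_profiles n m"
proof -
  have "AE \<omega> in M. \<forall>i\<in>{1..n}. k i \<omega> \<le> m i"
    using count_le by (intro AE_finite_allI) auto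
  then show ?thesis
    using AE_space
  proof eventually_elim
    case (elim \<omega>)
    then show ?case
      using vote_values by (auto simp: vote_profiles_def committee_profiles_def tuple_def)
  qed
qed

text \<open>The event is partitioned by the observed profile, on which the value of \<open>f\<close>
  is constant.\<close>

lemma agreement_prob:
  "\<P>(\<omega> in M. (tuple n X \<omega>, tuple n k \<omega>) \<in> vote_profiles n \<times> committee_profiles n m
      \<and> Y \<omega> = f (tuple n X \<omega>, tuple n k \<omega>)) =
    (\<Sum>(x, \<kappa>) \<in> vote_profiles n \<times> committee_profiles n m.
      \<P>(\<omega> in M. Y \<omega> = f (x, \<kappa>) \<and> tuple n X \<omega> = x \<and> tuple n k \<omega> = \<kappa>))"
proof -
  let ?D = "vote_profiles n \<times> committee_profiles n m"
  let ?E = "\<lambda>z. {\<omega> \<in> space M. Y \<omega> = f z \<and> tuple n X \<omega> = fst z \<and> tuple n k \<omega> = snd z}"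
  have "{\<omega> \<in> space M. (tuple n X \<omega>, tuple n k \<omega>) \<in> ?D \<and> Y \<omega> = f (tuple n X \<omega>, tuple n k \<omega>)} =
      (\<Union>z\<in>?D. ?E z)"
    by auto
  moreover have "prob (\<Union>z\<in>?D. ?E z) = (\<Sum>z\<in>?D. prob (?E z))"
    using finite_profiles joint_event
    by (intro finite_measure_finite_Union) (auto simp: disjoint_family_on_def prod_eq_iff)
  ultimately show ?thesis by (simp add: case_prod_beta)
qed

lemma error_prob:
  "\<P>(\<omega> in M. f (tuple n X \<omega>, tuple n k \<omega>) \<noteq> Y \<omega>) =
    1 - (\<Sum>(x, \<kappa>) \<in> vote_profiles n \<times> committee_profiles n m.
      \<P>(\<omega> in M. Y \<omega> = f (x, \<kappa>) \<and> tuple n X \<omega> = x \<and> tuple n k \<omega> = \<kappa>))"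
proof -
  let ?D = "vote_profiles n \<times> committee_profiles n m"
  let ?T = "\<lambda>\<omega>. (tuple n X \<omega>, tuple n k \<omega>)"
  let ?G = "{\<omega> \<in> space M. ?T \<omega> \<in> ?D \<and> Y \<omega> = f (?T \<omega>)}"
  have G: "?G \<in> events"
  proof -
    have "?G = (\<Union>z\<in>?D. {\<omega> \<in> space M. Y \<omega> = f z \<and> tuple n X \<omega> = fst z \<and> tuple n k \<omega> = snd z})"
      by auto
    then show ?thesis using finite_profiles joint_event by (auto intro!: sets.finite_UN)
  qed
  have "prob {\<omega> \<in> space M. f (?T \<omega>) \<noteq> Y \<omega>} = prob (space M - ?G)"
  proof (rule finite_measure_eq_AE)
    show "AE \<omega> in M. \<omega> \<in> {\<omega> \<in> space M. f (?T \<omega>) \<noteq> Y \<omega>} \<longleftrightarrow> \<omega> \<in> space M - ?G"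
      using profiles_AE by eventually_elim auto
    \<comment> \<open>Measurability of the error event must also cover counts above
      \<open>m i\<close>, where \<open>f\<close> is arbitrary; all natural counts give a countable
      cover.\<close>
    let ?C = "vote_profiles n \<times> ({1..n} \<rightarrow>\<^sub>E (UNIV :: nat set))"
    have "{\<omega> \<in> space M. f (?T \<omega>) \<noteq> Y \<omega>} =
        (\<Union>z\<in>?C. {\<omega> \<in> space M. tuple n X \<omega> = fst z} \<inter> {\<omega> \<in> space M. tuple n k \<omega> = snd z}
          - {\<omega> \<in> space M. Y \<omega> = f z})"
      using vote_values by (fastforce simp: vote_profiles_def tuple_def)
    moreover have "countable ?C"
      unfolding vote_profiles_def by (intro countable_SIGMA countable_PiE) auto
    ultimately show "{\<omega> \<in> space M. f (?T \<omega>) \<noteq> Y \<omega>} \<in> events"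
      using tuple_vote_event tuple_count_event truth_event by (auto intro!: sets.countable_UN')
  qed (use G in auto)
  also have "\<dots> = 1 - prob ?G" using prob_compl[OF G] .
  finally show ?thesis unfolding agreement_prob .
qed

end

section \<open>Posterior maximality and Bayes optimality\<close>

theorem mainTheorem5:
  fixes M :: "'a measure"
    and n :: nat
    and m :: "nat \<Rightarrow> nat"
    and \<alpha> \<beta> :: "nat \<Rightarrow> real"
    and p :: "nat \<Rightarrow> 'a \<Rightarrow> real"
    and Y :: "'a \<Rightarrow> int"
    and K :: "nat \<Rightarrow> 'a \<Rightarrow> nat"
    and X :: "nat \<Rightarrow> 'a \<Rightarrow> int"
    and s :: int
  assumes "n \<ge> 1"
    and "\<And>i. i \<in> {1..n} \<Longrightarrow> m i \<ge> 1"
    and "\<And>i. i \<in> {1..n} \<Longrightarrow> \<alpha> i > 0"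
    and "\<And>i. i \<in> {1..n} \<Longrightarrow> \<beta> i > 0"
    and "bayes_committee M n m \<alpha> \<beta> p Y K X"
    and "s \<in> {-1, 1}"
  shows "(\<forall>x \<in> vote_profiles n. \<forall>k \<in> committee_profiles n m.
            \<P>(\<omega> in M. tuple n X \<omega> = x \<and> tuple n K \<omega> = k) > 0 \<and>
            is_arg_max
              (\<lambda>y. \<P>(\<omega> in M. Y \<omega> = y \<bar> tuple n X \<omega> = x \<and> tuple n K \<omega> = k))
              (\<lambda>y. y \<in> {-1, 1})
              (bayes_rule s n m \<alpha> \<beta> (x, k)))
       \<and> is_arg_min
           (\<lambda>f. \<P>(\<omega> in M. f (tuple n X \<omega>, tuple n K \<omega>) \<noteq> Y \<omega>))
           (\<lambda>f. f \<in> decision_rules n m)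
           (bayes_rule s n m \<alpha> \<beta>)"
proof (intro conjI ballI)
  interpret C: bayes_committee M n m \<alpha> \<beta> p Y K X by fact
  let ?r = "bayes_rule s n m \<alpha> \<beta>"
  have pos: "\<forall>i\<in>{1..n}. \<alpha> i > 0 \<and> \<beta> i > 0"
    using assms(3,4) by blast
  {
    fix x k assume x: "x \<in> vote_profiles n" and k: "k \<in> committee_profiles n m"
    have "0 < \<P>(\<omega> in M. Y \<omega> = 1 \<and> tuple n X \<omega> = x \<and> tuple n K \<omega> = k)"
      using C.joint_prob_pos[OF x _ k pos] by simp
    also have "\<dots> \<le> \<P>(\<omega> in M. tuple n X \<omega> = x \<and> tuple n K \<omega> = k)"
      using C.tuple_vote_event C.tuple_count_event
      by (intro C.finite_measure_mono sets.sets_Collect_conj) auto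
    finally show *: "\<P>(\<omega> in M. tuple n X \<omega> = x \<and> tuple n K \<omega> = k) > 0" .
    have "?r (x, k) \<in> {-1, 1}"
      using C.bayes_rule_decision[OF assms(6)] x k by (auto simp: decision_rules_def)
    \<comment> \<open>The posterior is the joint probability divided by the probability of the
      profile, which is positive and does not depend on \<open>y\<close>.\<close>
    then show "is_arg_max
              (\<lambda>y. \<P>(\<omega> in M. Y \<omega> = y \<bar> tuple n X \<omega> = x \<and> tuple n K \<omega> = k))
              (\<lambda>y. y \<in> {-1, 1}) (?r (x, k))"
      using C.bayes_rule_joint_maximal[OF x _ k assms(6) pos] *
      by (auto simp: is_arg_max_linorder cond_prob_def divide_right_mono)
  }
  \<comment> \<open>The error is one minus a sum over profiles, and the Bayes rule maximizes every
    summand.\<close>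
  have "\<P>(\<omega> in M. ?r (tuple n X \<omega>, tuple n K \<omega>) \<noteq> Y \<omega>)
      \<le> \<P>(\<omega> in M. f (tuple n X \<omega>, tuple n K \<omega>) \<noteq> Y \<omega>)" if f: "f \<in> decision_rules n m" for f
    unfolding C.error_prob
    by (intro diff_left_mono sum_mono)
      (use f C.bayes_rule_joint_maximal[OF _ _ _ assms(6) pos] in \<open>force simp: decision_rules_def\<close>)
  then show "is_arg_min
           (\<lambda>f. \<P>(\<omega> in M. f (tuple n X \<omega>, tuple n K \<omega>) \<noteq> Y \<omega>))
           (\<lambda>f. f \<in> decision_rules n m) ?r"
    using C.bayes_rule_decision[OF assms(6)] by (simp add: is_arg_min_linorder)
qed

end
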